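(* Fix a real $\beta$ with $0<\beta<1/2$ and set $K=\lfloor\exp\{(\log n)^\beta\}\rfloor$. For all sufficiently large $n$, there is a simple graph $H_n$ on the vertex set $\{2,\ldots,n\}$ satisfying $d_{H_n}(v)=d_{G_n}(v)$ for every vertex $v$ and \[ \alpha(H_n)\le \sum_{k=1}^{K}\left\lfloor\frac{m_k(n)}{k}\right\rfloor+\pi\!\left(\frac{n}{K+1}\right)+2\pi(\sqrt n)+K^2 . \]
   Context: For an integer $n\ge2$, $G_n$ is the simple graph with vertex set $\{2,\ldots,n\}$ in which two distinct vertices $x,y$ are adjacent if and only if $\gcd(x,y)>1$. $d_G(v)$ is the degree of $v$ in $G$, $\alpha(G)$ is the independence number (largest size of an independent vertex set), and $\pi(x)$ is the number of primes at most $x$. For $k\ge1$, $m_k(n)$ is the number of primes $p\le n$ with $\lfloor n/p\rfloor=k$. Logarithms are natural. "Sufficiently large" may depend on $\beta$. *)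

theory Defs
  imports
    "HOL-Analysis.Analysis"
    "HOL-Computational_Algebra.Primes"
    "Graph_Theory.Pair_Digraph"
begin

text \<open>
  Finite simple graphs are rendered by the locale \<^locale>\<open>pair_graph\<close> (finite, loop-free,
  symmetric arc relation), with each edge contributing an arc in both directions.
  Hence the degree of a vertex in the undirected sense is its
  \<^const>\<open>out_degree\<close>, the number of its neighbours.
\<close>

abbreviation vertex_degree :: "'a pair_pre_digraph \<Rightarrow> 'a \<Rightarrow> nat" where
  "vertex_degree G v \<equiv> out_degree (with_proj G) v"

definition independent_set :: "'a pair_pre_digraph \<Rightarrow> 'a set \<Rightarrow> bool" where
  "independent_set G S \<longleftrightarrow> S \<subseteq> pverts G \<and> (\<forall>u\<in>S. \<forall>v\<in>S. (u, v) \<notin> parcs G)"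

text \<open>Only meaningful when the vertex set is finite.\<close>

definition independence_number :: "'a pair_pre_digraph \<Rightarrow> nat" where
  "independence_number G = Max (card ` {S. independent_set G S})"

definition gcd_graph :: "nat \<Rightarrow> nat pair_pre_digraph" where
  "gcd_graph n = \<lparr> pverts = {2..n},
     parcs = {(x, y). x \<in> {2..n} \<and> y \<in> {2..n} \<and> x \<noteq> y \<and> gcd x y > 1} \<rparr>"

lemma pair_graph_gcd_graph: "pair_graph (gcd_graph n)"
proof -
  have "finite (parcs (gcd_graph n))"
    by (rule finite_subset[of _ "{2..n} \<times> {2..n}"]) (auto simp: gcd_graph_def)
  then show ?thesis
    by unfold_locales
      (auto simp: gcd_graph_def symmetric_def gcd.commute intro!: symI)
qed

definition prime_pi :: "real \<Rightarrow> nat" where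
  "prime_pi x = card {p :: nat. prime p \<and> real p \<le> x}"

text \<open>On natural numbers, \<open>n div p\<close> is the floor of \<open>n / p\<close>.\<close>

definition prime_quotient_count :: "nat \<Rightarrow> nat \<Rightarrow> nat" where
  "prime_quotient_count k n = card {p. prime p \<and> p \<le> n \<and> n div p = k}"

end

theory Submission
  imports Defs "HOL-Real_Asymp.Real_Asymp"
begin

text \<open>
  A prime \<open>p > n / (K + 1)\<close> with \<open>n div p = k\<close> has degree \<open>k - 1\<close> in the gcd graph, its
  neighbours being \<open>2p, \<dots>, kp\<close>. Delete these edges and join the primes with the same
  \<open>k\<close> into cliques of size \<open>k\<close>; up to fewer than \<open>k\<close> leftover primes, which keep their
  edges, each such clique costs an independent set only one vertex. Every multiple
  \<open>jp\<close>, \<open>2 \<le> j \<le> k\<close>, is now short of one edge. Let \<open>\<sigma>\<close> be a permutation of the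
  regrouped primes that preserves \<open>k\<close> and has no fixed point when \<open>k \<ge> 2\<close>. Adding the
  edges from \<open>jp\<close> to \<open>(j + 1)\<sigma>(p)\<close> for even \<open>j < k\<close> repairs all multiples except \<open>kp\<close> for
  even \<open>k\<close>. For these take \<open>\<sigma>\<close> to be an involution, choose a companion \<open>c(p)\<close> (namely
  \<open>(k - 1)p\<close> if \<open>k \<ge> 4\<close>, and an odd multiple of \<open>3\<close> if \<open>k = 2\<close>), delete the edges between
  \<open>c(p)\<close> and \<open>c(\<sigma>(p))\<close>, and add the edges between \<open>kp\<close> and \<open>c(\<sigma>(p))\<close>. The edges deleted
  between composite numbers form a matching, so an independent set has at most two
  composite multiples of each prime up to \<open>\<surd>n\<close>.
\<close>

section \<open>Degrees\<close>

lemma vertex_degree_eq_card_Image: "vertex_degree G v = card (parcs G `` {v})"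
proof -
  have "out_arcs (with_proj G) v = Pair v ` (parcs G `` {v})"
    by (auto simp: out_arcs_def)
  then show ?thesis
    by (simp add: out_degree_def card_image inj_on_def)
qed

text \<open>The undirected edges joining \<open>f i\<close> to \<open>g i\<close>, each stored as
  two arcs.\<close>

definition sym_pairs :: "('i \<Rightarrow> 'a) \<Rightarrow> ('i \<Rightarrow> 'a) \<Rightarrow> 'i set \<Rightarrow> ('a \<times> 'a) set" where
  "sym_pairs f g I = (\<lambda>i. (f i, g i)) ` I \<union> (\<lambda>i. (g i, f i)) ` I"

lemma even_odd_images_disjoint:
  assumes "\<And>i. i \<in> I \<Longrightarrow> even (f i)" "\<And>i. i \<in> I \<Longrightarrow> odd (g i)"
  shows "f ` I \<inter> g ` I = {}"
proof -
  have "f i \<noteq> g j" if "i \<in> I" "j \<in> I" for i j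
    using assms(1)[OF that(1)] assms(2)[OF that(2)] by auto
  then show ?thesis by blast
qed

lemma sym_sym_pairs: "sym (sym_pairs f g I)"
  by (auto simp: sym_def sym_pairs_def)

text \<open>The pairs form a matching: injectivity leaves a covered vertex only one index,
  disjointness of the images only one side, so it has exactly one partner.\<close>

lemma card_Image_sym_pairs:
  assumes inj_f: "inj_on f I" and inj_g: "inj_on g I" and disj: "f ` I \<inter> g ` I = {}"
  shows "card (sym_pairs f g I `` {v}) = of_bool (v \<in> f ` I) + of_bool (v \<in> g ` I)"
proof -
  consider (f) i where "i \<in> I" "v = f i" | (g) i where "i \<in> I" "v = g i"
    | (none) "v \<notin> f ` I" "v \<notin> g ` I"
    by blast
  then show ?thesis
  proof cases
    case f
    have "sym_pairs f g I `` {v} = {g i}"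
      using f disj by (auto simp: sym_pairs_def inj_on_eq_iff[OF inj_f])
    moreover have "v \<in> f ` I" "v \<notin> g ` I"
      using f disj by auto
    ultimately show ?thesis by simp
  next
    case g
    have "sym_pairs f g I `` {v} = {f i}"
      using g disj by (auto simp: sym_pairs_def inj_on_eq_iff[OF inj_g])
    moreover have "v \<in> g ` I" "v \<notin> f ` I"
      using g disj by auto
    ultimately show ?thesis by simp
  next
    case none
    then have "sym_pairs f g I `` {v} = {}"
      by (auto simp: sym_pairs_def)
    with none show ?thesis by simp
  qed
qed

lemma disjoint_relI:
  assumes "\<And>x y. (x, y) \<in> A \<Longrightarrow> (x, y) \<notin> B"
  shows "A \<inter> B = {}"
  using assms by (auto simp: disjoint_iff)

lemma card_Image_Un_disjoint:
  assumes "finite A" "finite B" "A \<inter> B = {}"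
  shows "card ((A \<union> B) `` {v}) = card (A `` {v}) + card (B `` {v})"
  unfolding Un_Image using assms by (intro card_Un_disjoint) auto

text \<open>The switching principle: \<open>v\<close> gains as many neighbours as it loses.
  \<open>R\<close> inside \<open>E\<close> and \<open>A\<close> disjoint from \<open>E\<close> make
  every loss and every gain count.\<close>

lemma card_Image_Diff_Un:
  assumes "finite E" "R \<subseteq> E" "finite A" "A \<inter> E = {}"
    and "card (R `` {v}) = card (A `` {v})"
  shows "card (((E - R) \<union> A) `` {v}) = card (E `` {v})"
proof -
  have *: "((E - R) \<union> A) `` {v} = (E `` {v} - R `` {v}) \<union> A `` {v}" by auto
  have fin: "finite (E `` {v})" "finite (A `` {v})" "finite (R `` {v})"
    using assms finite_subset by (auto intro!: finite_Image)
  have sub: "R `` {v} \<subseteq> E `` {v}" using assms by auto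
  have "card (((E - R) \<union> A) `` {v}) = card (E `` {v} - R `` {v}) + card (A `` {v})"
    unfolding * using assms fin by (intro card_Un_disjoint) auto
  then show ?thesis
    using assms(5) fin sub card_mono[OF fin(1) sub] by (simp add: card_Diff_subset)
qed

section \<open>Block partitions\<close>

text \<open>If \<open>k\<close> is even, so is \<open>N\<close>, and swapping \<open>2 * i\<close>
  with \<open>2 * i + 1\<close> serves. If \<open>k\<close> is odd, \<open>N\<close> may be odd and
  then admits no such involution; the cyclic shift moves every point, since a nonzero
  \<open>N\<close> is at least \<open>k\<close>.\<close>

lemma ex_fixpoint_free_permutation:
  fixes k N :: nat
  assumes "k dvd N"
  shows "\<exists>\<sigma>. bij_betw \<sigma> {..<N} {..<N} \<and> (\<forall>i<N. k \<ge> 2 \<longrightarrow> \<sigma> i \<noteq> i)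
    \<and> (\<forall>i<N. even k \<longrightarrow> \<sigma> (\<sigma> i) = i)"
proof (cases "even k")
  case True
  define \<sigma> :: "nat \<Rightarrow> nat" where "\<sigma> i = (if even i then i + 1 else i - 1)" for i
  have "even N" using True assms by auto
  then have *: "\<sigma> i < N" if "i < N" for i
    using that unfolding \<sigma>_def by (auto elim!: evenE oddE)
  have inv: "\<sigma> (\<sigma> i) = i" for i by (auto simp: \<sigma>_def)
  have "\<sigma> i \<noteq> i" for i by (auto simp: \<sigma>_def elim: oddE)
  moreover have "bij_betw \<sigma> {..<N} {..<N}"
    by (rule bij_betwI[of _ _ _ \<sigma>]) (auto simp: * inv)
  ultimately show ?thesis using inv by blast
next
  case False
  define \<sigma> :: "nat \<Rightarrow> nat" where "\<sigma> i = (if i + 1 = N then 0 else i + 1)" for i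
  have "bij_betw \<sigma> {..<N} {..<N}"
    by (rule bij_betwI[of _ _ _ "\<lambda>i. if i = 0 then N - 1 else i - 1"]) (auto simp: \<sigma>_def)
  moreover have "\<sigma> i \<noteq> i" if "k \<ge> 2" "i < N" for i
    using that assms dvd_imp_le[of k N] by (auto simp: \<sigma>_def)
  ultimately show ?thesis using False by blast
qed

text \<open>\<open>Q\<close> is the part of \<open>P\<close> cut into blocks of size
  \<open>k\<close>, and \<open>b\<close> is the block label. Labels below
  \<open>card P div k\<close> produce the floors in the final bound. \<open>\<sigma>\<close>
  permutes all of \<open>Q\<close> and need not respect the blocks.\<close>

definition block_partition :: "'a set \<Rightarrow> nat \<Rightarrow> 'a set \<Rightarrow> ('a \<Rightarrow> nat) \<Rightarrow> ('a \<Rightarrow> 'a) \<Rightarrow> bool" where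
  "block_partition P k Q b \<sigma> \<longleftrightarrow> Q \<subseteq> P \<and> card (P - Q) < k \<and> b ` Q \<subseteq> {..<card P div k}
    \<and> (\<forall>x\<in>Q. card {y\<in>Q. b y = b x} = k)
    \<and> bij_betw \<sigma> Q Q \<and> (\<forall>x\<in>Q. k \<ge> 2 \<longrightarrow> \<sigma> x \<noteq> x) \<and> (\<forall>x\<in>Q. even k \<longrightarrow> \<sigma> (\<sigma> x) = x)"

text \<open>Number the elements of \<open>P\<close>, keep the indices below the largest multiple of
  \<open>k\<close> up to \<open>card P\<close>, label an element by its index divided by
  \<open>k\<close>, and transport a permutation of the indices along the numbering.\<close>

lemma ex_block_partition:
  assumes "finite P" and "k \<ge> 1"
  shows "\<exists>Q b \<sigma>. block_partition P k Q b \<sigma>"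
proof -
  obtain h where h: "bij_betw h P {..<card P}"
    using ex_bij_betw_finite_nat[OF assms(1)] by (auto simp: atLeast0LessThan)
  define N where "N = k * (card P div k)"
  have N_le: "N \<le> card P" by (simp add: N_def)
  define Q where "Q = {x \<in> P. h x < N}"
  have "h ` Q = {..<N}"
    using h N_le unfolding Q_def bij_betw_def
    by (auto simp: image_iff set_eq_iff) (metis imageE lessThan_iff order_less_le_trans)
  then have hQ: "bij_betw h Q {..<N}"
    using h unfolding bij_betw_def Q_def inj_on_def by blast
  define h' where "h' = inv_into Q h"
  have h': "bij_betw h' {..<N} Q"
    unfolding h'_def by (rule bij_betw_inv_into[OF hQ])
  have h'h: "h' (h x) = x" if "x \<in> Q" for x
    using that hQ by (simp add: h'_def bij_betw_inv_into_left)
  have hh': "h (h' i) = i" if "i < N" for i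
    using that hQ by (simp add: h'_def bij_betw_inv_into_right)
  have hN: "h x < N" if "x \<in> Q" for x using that by (simp add: Q_def)
  have h'Q: "h' i \<in> Q" if "i < N" for i
    using that h' by (auto simp: bij_betw_def)
  obtain s where s: "bij_betw s {..<N} {..<N}"
      "\<And>i. i < N \<Longrightarrow> k \<ge> 2 \<Longrightarrow> s i \<noteq> i" "\<And>i. i < N \<Longrightarrow> even k \<Longrightarrow> s (s i) = i"
    using ex_fixpoint_free_permutation[of k N] by (auto simp: N_def)
  have sN: "s i < N" if "i < N" for i using that s(1) by (auto simp: bij_betw_def)
  define \<sigma> where "\<sigma> = h' \<circ> s \<circ> h"
  define b where "b x = h x div k" for x
  have bij: "bij_betw \<sigma> Q Q"
    unfolding \<sigma>_def using hQ s(1) h' by (blast intro: bij_betw_trans)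
  have neq: "\<forall>x\<in>Q. k \<ge> 2 \<longrightarrow> \<sigma> x \<noteq> x"
    by (metis \<sigma>_def comp_apply hN hh' s(2) sN)
  have invol: "\<forall>x\<in>Q. even k \<longrightarrow> \<sigma> (\<sigma> x) = x"
    by (simp add: \<sigma>_def hN hh' s(3) sN h'h)
  have img: "b ` Q \<subseteq> {..<card P div k}"
    using hN assms(2) by (auto simp: b_def N_def less_mult_imp_div_less mult.commute)
  have fib: "card {y\<in>Q. b y = b x} = k" if x: "x \<in> Q" for x
  proof -
    have bx: "b x < card P div k"
      using img x by auto
    \<comment> \<open>A block corresponds to \<open>k\<close> consecutive indices, starting at
      \<open>k * b x\<close>.\<close>
    have 1: "bij_betw h {y\<in>Q. b y = b x} {k * b x..<k * b x + k}"
    proof (rule bij_betwI[of _ _ _ h'])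
      show "h \<in> {y \<in> Q. b y = b x} \<rightarrow> {k * b x..<k * b x + k}"
      proof
        fix y assume y: "y \<in> {y \<in> Q. b y = b x}"
        then have "k * b x + h y mod k = h y"
          by (metis (mono_tags, lifting) b_def mem_Collect_eq mult_div_mod_eq)
        moreover have "h y mod k < k" using assms(2) by simp
        ultimately show "h y \<in> {k * b x..<k * b x + k}" by auto
      qed
      have *: "i < N" "i div k = b x" if "i \<in> {k * b x..<k * b x + k}" for i
      proof -
        have "k * b x + k \<le> k * (card P div k)"
          using bx by (metis Suc_leI mult_Suc_right mult_le_mono2 add.commute)
        then show "i < N" using that by (auto simp: N_def)
        show "i div k = b x"
          using that by (intro div_nat_eqI) (auto simp: mult.commute)
      qed
      then show "h' \<in> {k * b x..<k * b x + k} \<rightarrow> {y \<in> Q. b y = b x}"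
        by (auto simp: h'Q hh' b_def[of "h' _"])
      show "h' (h y) = y" if "y \<in> {y \<in> Q. b y = b x}" for y
        using that h'h by auto
      show "h (h' i) = i" if "i \<in> {k * b x..<k * b x + k}" for i
        using *[OF that] hh' by auto
    qed
    show ?thesis using bij_betw_same_card[OF 1] by simp
  qed
  have sub: "Q \<subseteq> P" by (auto simp: Q_def)
  have rest: "card (P - Q) < k"
  proof -
    have "card Q = N" using bij_betw_same_card[OF hQ] by simp
    then have "card (P - Q) = card P mod k"
      using \<open>Q \<subseteq> P\<close> assms(1)
      by (simp add: card_Diff_subset finite_subset N_def minus_mult_div_eq_mod)
    then show ?thesis using assms(2) by simp
  qed
  show ?thesis
    unfolding block_partition_def
    by (rule exI[of _ Q], rule exI[of _ b], rule exI[of _ \<sigma>])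
      (intro conjI sub rest img bij neq invol ballI fib)
qed

section \<open>The switched graph\<close>

text \<open>\<open>Q\<close> holds the regrouped primes for all quotients at once. Labels may repeat
  between quotients, so a block is determined by the pair of \<open>n div p\<close> and
  \<open>b p\<close>. The bound \<open>n_ge\<close> ensures
  \<open>(n + 22) / 2 \<le> 3 * n / 5\<close>, which separates the two kinds of companions.\<close>

locale prime_blocks =
  fixes n K :: nat and Q :: "nat set" and b \<sigma> :: "nat \<Rightarrow> nat"
  assumes n_ge: "n \<ge> 120"
    and K_less: "(K + 1)\<^sup>2 \<le> n"
    and Q: "\<And>p. p \<in> Q \<Longrightarrow> prime p \<and> p \<le> n \<and> n div p \<le> K"
    and card_block: "\<And>p. p \<in> Q \<Longrightarrow> card {q\<in>Q. n div q = n div p \<and> b q = b p} = n div p"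
    and \<sigma>_bij: "bij_betw \<sigma> Q Q"
    and \<sigma>_div: "\<And>p. p \<in> Q \<Longrightarrow> n div \<sigma> p = n div p"
    and \<sigma>_neq: "\<And>p. p \<in> Q \<Longrightarrow> n div p \<ge> 2 \<Longrightarrow> \<sigma> p \<noteq> p"
    and \<sigma>_invol: "\<And>p. p \<in> Q \<Longrightarrow> even (n div p) \<Longrightarrow> \<sigma> (\<sigma> p) = p"
begin

definition Q_even :: "nat set" where
  "Q_even = {p \<in> Q. even (n div p)}"

definition proper_multiples :: "nat set" where
  "proper_multiples = {j * p | j p. p \<in> Q \<and> 2 \<le> j \<and> j \<le> n div p}"

text \<open>For \<open>k = n div p = 2\<close> the vertex \<open>(k - 1) * p\<close> is \<open>p\<close> itself, so an odd
  multiple of \<open>3\<close> takes its place; the summand \<open>2\<close> keeps it from being \<open>3\<close>.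
  Subtracting \<open>2 * (n div 6)\<close> pushes it below about \<open>n / 2\<close>, whereas \<open>(k - 1) * p\<close> exceeds \<open>3 * n / 5\<close>
  for \<open>k \<ge> 4\<close>; hence all companions are distinct.\<close>

definition companion :: "nat \<Rightarrow> nat" where
  "companion p = (if n div p = 2 then 3 * (p - 2 * (n div 6) + 2) else (n div p - 1) * p)"

definition stars :: "(nat \<times> nat) set" where
  "stars = {(p, j * p) | j p. p \<in> Q \<and> 2 \<le> j \<and> j \<le> n div p}
    \<union> {(j * p, p) | j p. p \<in> Q \<and> 2 \<le> j \<and> j \<le> n div p}"

text \<open>Already symmetric, since \<open>\<sigma>\<close> is an involution on
  \<open>Q_even\<close>: the arc indexed by \<open>\<sigma> p\<close> reverses the one indexed by
  \<open>p\<close>.\<close>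

definition companion_edges :: "(nat \<times> nat) set" where
  "companion_edges = (\<lambda>p. (companion p, companion (\<sigma> p))) ` Q_even"

definition block_edges :: "(nat \<times> nat) set" where
  "block_edges = {(p, q). p \<in> Q \<and> q \<in> Q \<and> n div q = n div p \<and> b q = b p \<and> q \<noteq> p}"

text \<open>Cofactors are paired as 2 with 3, 4 with 5, and so on. The bound on \<open>j + 1\<close>
  keeps \<open>(j + 1) * \<sigma> p\<close> at most \<open>n\<close>, because
  \<open>\<sigma>\<close> preserves the quotient.\<close>

definition step_index :: "(nat \<times> nat) set" where
  "step_index = {(j, p). p \<in> Q \<and> even j \<and> 2 \<le> j \<and> j + 1 \<le> n div p}"

definition step_edges :: "(nat \<times> nat) set" where
  "step_edges = sym_pairs (\<lambda>(j, p). j * p) (\<lambda>(j, p). (j + 1) * \<sigma> p) step_index"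

definition top_edges :: "(nat \<times> nat) set" where
  "top_edges = sym_pairs (\<lambda>p. (n div p) * p) (\<lambda>p. companion (\<sigma> p)) Q_even"

definition switched_graph :: "nat pair_pre_digraph" where
  "switched_graph = \<lparr> pverts = {2..n},
     parcs = (parcs (gcd_graph n) - (stars \<union> companion_edges))
       \<union> (block_edges \<union> step_edges \<union> top_edges) \<rparr>"

section \<open>Arithmetic of the regrouped primes and their multiples\<close>

lemma Q_prime: "p \<in> Q \<Longrightarrow> prime p"
  and Q_le: "p \<in> Q \<Longrightarrow> p \<le> n"
  and Q_div_le: "p \<in> Q \<Longrightarrow> n div p \<le> K"
  using Q by blast+

lemma Q_less_mult: "p \<in> Q \<Longrightarrow> n < (n div p + 1) * p"
  using Q_prime[of p] prime_gt_0_nat[of p] dividend_less_div_times[of p n] by (simp add: algebra_simps)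

text \<open>Otherwise both factors in \<open>n < (n div p + 1) * p\<close> would be at most
  \<open>K + 1\<close>, against \<open>K_less\<close>. Hence no prime of \<open>Q\<close> divides a
  positive cofactor up to \<open>K\<close>.\<close>

lemma Q_gt: assumes "p \<in> Q" shows "p > K + 1"
proof (rule ccontr)
  assume "\<not> p > K + 1"
  then have "(n div p + 1) * p \<le> (K + 1) * (K + 1)"
    using Q_div_le[OF assms] by (intro mult_mono) auto
  then show False using Q_less_mult[OF assms] K_less by (simp add: power2_eq_square)
qed

lemma Q_div_pos: assumes "p \<in> Q" shows "n div p \<ge> 1"
  using Q_le[OF assms] Q_prime[OF assms] by (simp add: Suc_leI div_greater_zero_iff prime_gt_0_nat)

lemma Q_odd: assumes "p \<in> Q" shows "odd p"
proof -
  have "K \<ge> 1" using Q_div_pos[OF assms] Q_div_le[OF assms] by simp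
  then show ?thesis using Q_gt[OF assms] Q_prime[OF assms] prime_odd_nat[of p] by simp
qed

lemma \<sigma>_in: "p \<in> Q \<Longrightarrow> \<sigma> p \<in> Q"
  using \<sigma>_bij by (auto simp: bij_betw_def)

lemma \<sigma>_inj: "inj_on \<sigma> Q"
  using \<sigma>_bij by (auto simp: bij_betw_def)

lemma coprime_Q: assumes "p \<in> Q" "0 < j" "j \<le> K" shows "coprime p j"
proof -
  have "\<not> p dvd j" using assms Q_gt[OF assms(1)] by (auto dest: dvd_imp_le)
  then show ?thesis using Q_prime[OF assms(1)] by (simp add: prime_imp_coprime)
qed

text \<open>\<open>p\<close> divides \<open>i * q\<close> but is coprime to
  \<open>i \<le> K\<close>, so it divides the prime \<open>q\<close>. Thus a multiple determines
  both its prime and its cofactor.\<close>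

lemma Q_multiple_eqD:
  assumes "j * p = i * q" "p \<in> Q" "q \<in> Q" "1 \<le> j" "1 \<le> i" "j \<le> n div p" "i \<le> n div q"
  shows "j = i \<and> p = q"
proof -
  have "p dvd i * q" using assms(1) by (metis dvd_triv_right)
  moreover have "coprime p i"
    using coprime_Q[of p i] assms Q_div_le[of q] by auto
  ultimately have "p dvd q" using coprime_dvd_mult_right_iff by blast
  then have "p = q" using Q_prime assms by (simp add: primes_dvd_imp_eq)
  then show ?thesis using assms Q_prime[of q] by auto
qed

text \<open>The primes are distinct and exceed \<open>K\<close>, so they are coprime to each other
  and to the cofactors; only the cofactors could share a divisor.\<close>

lemma coprime_multiples:
  assumes "p \<in> Q" "q \<in> Q" "p \<noteq> q" "1 \<le> j" "1 \<le> i" "j \<le> n div p" "i \<le> n div q" "coprime j i"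
  shows "coprime (j * p) (i * q)"
proof -
  have "j \<le> K" "i \<le> K" using assms Q_div_le[of p] Q_div_le[of q] by auto
  then have "coprime p i" "coprime q j"
    using assms coprime_Q by auto
  moreover have "coprime p q"
    using assms Q_prime primes_coprime by blast
  ultimately show ?thesis
    using assms(8) by (simp add: coprime_mult_left_iff coprime_mult_right_iff coprime_commute)
qed

lemma mult_le_n: assumes "j \<le> n div p" shows "j * p \<le> n"
  by (metis assms div_times_less_eq_dividend le_trans mult_le_mono1)

lemma not_prime_mult: assumes "p \<in> Q" "2 \<le> j" shows "\<not> prime (j * p)"
  using assms Q_gt[of p] by (auto dest: prime_product)

section \<open>Companions of the primes with even quotient\<close>

lemma Q_even_in: "p \<in> Q_even \<Longrightarrow> p \<in> Q"
  and Q_even_even: "p \<in> Q_even \<Longrightarrow> even (n div p)"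
  and Q_even_ge: "p \<in> Q_even \<Longrightarrow> n div p \<ge> 2"
  using Q_div_pos[of p] by (auto simp: Q_even_def elim!: evenE)

lemma \<sigma>_Q_even: "p \<in> Q_even \<Longrightarrow> \<sigma> p \<in> Q_even"
  and \<sigma>_\<sigma>: "p \<in> Q_even \<Longrightarrow> \<sigma> (\<sigma> p) = p"
  by (auto simp: Q_even_def \<sigma>_in \<sigma>_div \<sigma>_invol)

lemma \<sigma>_image_Q_even: "\<sigma> ` Q_even = Q_even"
  by (metis \<sigma>_Q_even \<sigma>_\<sigma> image_eqI image_subsetI subsetI subset_antisym)

text \<open>Here \<open>n / 3 < p \<le> n / 2\<close>, so \<open>p\<close> exceeds
  \<open>2 * (n div 6)\<close> and the subtraction is genuine; even shifts keep \<open>y\<close>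
  odd. The bound \<open>n + 22\<close> comes from \<open>6 * p \<le> 3 * n\<close> and
  \<open>12 * (n div 6) \<ge> 2 * n - 10\<close>.\<close>

lemma companion_two:
  assumes "p \<in> Q" "n div p = 2"
  obtains y where "companion p = 3 * y" "y = p - 2 * (n div 6) + 2" "p > 2 * (n div 6)"
    "odd y" "3 \<le> y" "6 * y \<le> n + 22"
proof -
  define d where "d = n div 6"
  have d: "6 * d \<le> n" "n < 6 * d + 6" by (auto simp: d_def)
  have p: "2 * p \<le> n" "n < 3 * p"
    using assms Q_less_mult[OF assms(1)] mult_le_n[of 2 p] by auto
  have gt: "p > 2 * d" using d p by linarith
  show ?thesis
  proof
    show "companion p = 3 * (p - 2 * d + 2)" using assms by (simp add: companion_def d_def)
    show "p - 2 * d + 2 = p - 2 * (n div 6) + 2" "p > 2 * (n div 6)" using gt by (auto simp: d_def)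
    show "odd (p - 2 * d + 2)" using gt Q_odd[OF assms(1)] by auto
    show "3 \<le> p - 2 * d + 2" using gt by linarith
    obtain e where "p = 2 * d + e" using gt less_imp_add_positive by metis
    then show "6 * (p - 2 * d + 2) \<le> n + 22" using d p by simp
  qed
qed

text \<open>For \<open>k = n div p \<ge> 4\<close> one has
  \<open>5 * (k - 1) \<ge> 3 * (k + 1)\<close>, with equality at 4, and
  \<open>(k + 1) * p > n\<close>.\<close>

lemma companion_four:
  assumes "p \<in> Q_even" "n div p \<noteq> 2"
  shows "n div p \<ge> 4" "companion p = (n div p - 1) * p" "5 * companion p > 3 * n"
proof -
  note p = Q_even_in[OF assms(1)]
  show ge: "n div p \<ge> 4"
    using assms(2) Q_even_even[OF assms(1)] Q_even_ge[OF assms(1)]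
    by (cases "n div p = 3") auto
  show eq: "companion p = (n div p - 1) * p" using assms(2) by (simp add: companion_def)
  have "3 * n < 3 * ((n div p + 1) * p)" using Q_less_mult[OF p] by simp
  also have "3 * ((n div p + 1) * p) = (3 * (n div p + 1)) * p" by (simp only: mult.assoc)
  also have "\<dots> \<le> (5 * (n div p - 1)) * p"
  proof (rule mult_le_mono1)
    obtain m where "n div p = 4 + m" using ge le_Suc_ex by metis
    then show "3 * (n div p + 1) \<le> 5 * (n div p - 1)" by simp
  qed
  finally show "5 * companion p > 3 * n" by (simp only: eq mult.assoc)
qed

text \<open>Keeps companions away from the primes, so that companion edges are not star edges and
  top edges are not block edges.\<close>

lemma companion_not_prime: assumes "p \<in> Q_even" shows "\<not> prime (companion p)"
proof (cases "n div p = 2")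
  case True
  then obtain y where y: "companion p = 3 * y" "3 \<le> y"
    using companion_two[OF Q_even_in[OF assms]] by metis
  show ?thesis
  proof
    assume "prime (companion p)"
    from prime_product[OF this[unfolded y]] y show False by auto
  qed
next
  case False
  then show ?thesis
    using companion_four[OF assms False] not_prime_mult[OF Q_even_in[OF assms]] by simp
qed

text \<open>Parity separates companions from the even numbers \<open>(n div p) * p\<close> to which
  the top edges join them.\<close>

lemma companion_odd: assumes "p \<in> Q_even" shows "odd (companion p)"
proof (cases "n div p = 2")
  case True
  then show ?thesis
    using companion_two[OF Q_even_in[OF assms]]
    by (metis even_mult_iff odd_numeral)
next
  case False
  then show ?thesis
    using companion_four[OF assms False] Q_even_even[OF assms] Q_odd[OF Q_even_in[OF assms]] by simp
qed

lemma companion_range: assumes "p \<in> Q_even" shows "companion p \<in> {2..n}"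
proof (cases "n div p = 2")
  case True
  then obtain y where "companion p = 3 * y" "3 \<le> y" "6 * y \<le> n + 22"
    using companion_two[OF Q_even_in[OF assms]] by metis
  then show ?thesis using n_ge by auto
next
  case False
  then show ?thesis
    using companion_four[OF assms False] mult_le_n[of "n div p - 1" p] n_ge by auto
qed

text \<open>For quotient 2 the companion is linear in \<open>p\<close>; for larger quotients the
  multiple determines its prime. In the mixed case one companion is at most
  \<open>(n + 22) / 2\<close> and the other exceeds \<open>3 * n / 5\<close>.\<close>

lemma companion_inj: "inj_on companion Q_even"
proof (rule inj_onI)
  have mixed: False if pq: "p \<in> Q_even" "q \<in> Q_even" "companion p = companion q"
    and div: "n div p = 2" "n div q \<noteq> 2" for p q
  proof -
    obtain y where "companion p = 3 * y" "6 * y \<le> n + 22"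
      using companion_two[OF Q_even_in[OF pq(1)] div(1)] by metis
    then show False
      using companion_four(3)[OF pq(2) div(2)] pq(3) n_ge by linarith
  qed
  fix p q assume pq: "p \<in> Q_even" "q \<in> Q_even" "companion p = companion q"
  consider "n div p = 2" "n div q = 2" | "n div p \<noteq> 2" "n div q \<noteq> 2"
    using mixed pq by metis
  then show "p = q"
  proof cases
    case 1
    \<comment> \<open>The truncated differences cancel because both primes exceed
      \<open>2 * (n div 6)\<close>.\<close>
    then show ?thesis
      using companion_two[OF Q_even_in[OF pq(1)]] companion_two[OF Q_even_in[OF pq(2)]] pq(3)
      by (smt (verit) add_right_cancel le_add_diff_inverse2 less_imp_le nat_mult_eq_cancel_disj
          numeral_eq_iff zero_neq_numeral)
  next
    case 2
    have "(n div p - 1) * p = (n div q - 1) * q"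
      using companion_four(2)[OF pq(1) 2(1)] companion_four(2)[OF pq(2) 2(2)] pq(3) by simp
    then show ?thesis
      using Q_multiple_eqD[of _ p _ q] Q_even_in[OF pq(1)] Q_even_in[OF pq(2)]
        companion_four(1)[OF pq(1) 2(1)] companion_four(1)[OF pq(2) 2(2)] by fastforce
  qed
qed

text \<open>The shared quotient provides a common divisor: 3 if it is 2, and the quotient minus one
  otherwise.\<close>

lemma gcd_companion:
  assumes pq: "p \<in> Q_even" "q \<in> Q_even" "n div p = n div q"
  shows "gcd (companion p) (companion q) > 1"
proof -
  obtain d where d: "d > 1" "d dvd companion p" "d dvd companion q"
  proof (cases "n div p = 2")
    case True
    then have "3 dvd companion p" "3 dvd companion q"
      using assms by (auto simp: companion_def)
    then show ?thesis using that[of 3] by simp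
  next
    case False
    then show ?thesis
      using that[of "n div p - 1"] companion_four[OF pq(1)] companion_four[OF pq(2)] pq(3) by simp
  qed
  then have "d \<le> gcd (companion p) (companion q)"
    using companion_range[OF pq(1)] by (intro dvd_imp_le) (auto intro!: gcd_pos_nat[THEN iffD2])
  then show ?thesis using d by simp
qed

text \<open>For quotient 2 this is \<open>2 * p\<close> against \<open>3 * y\<close>, where
  \<open>y\<close> is odd and below \<open>p\<close>, as \<open>y \<le> (n + 22) / 6\<close> and
  \<open>p > n / 3\<close>. Otherwise consecutive cofactors multiply distinct primes.\<close>

lemma coprime_top_companion:
  assumes pq: "p \<in> Q_even" "q \<in> Q_even" "p \<noteq> q" "n div p = n div q"
  shows "coprime ((n div p) * p) (companion q)"
proof (cases "n div p = 2")
  case True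
  then obtain y where y: "companion q = 3 * y" "odd y" "3 \<le> y" "6 * y \<le> n + 22"
    using companion_two[OF Q_even_in[OF pq(2)]] pq(4) by metis
  have p: "prime p" "p > 3" "n < 3 * p"
    using Q_prime[OF Q_even_in[OF pq(1)]] Q_less_mult[OF Q_even_in[OF pq(1)]] True n_ge by auto
  have "y < p" using y(4) p(3) n_ge by linarith
  then have "\<not> p dvd y" using y(3) by (auto dest: dvd_imp_le)
  moreover have "\<not> p dvd 3" using p(2) by (auto dest: dvd_imp_le)
  ultimately have "coprime p 3" "coprime p y" using p(1) by (auto intro: prime_imp_coprime)
  then show ?thesis
    using y(2) unfolding y(1) True coprime_mult_left_iff coprime_mult_right_iff by simp
next
  case False
  note k = companion_four[OF pq(1) False]
  have "coprime (n div p) (n div p - 1)"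
    using k(1) by (intro coprime_diff_one_right_nat) auto
  then show ?thesis
    using k coprime_multiples[of p q "n div p" "n div p - 1"] pq Q_even_in
      companion_four(2)[OF pq(2)] by (simp add: False[unfolded pq(4)])
qed

section \<open>Degree contributions of the edge families\<close>

lemma proper_multiples_not_Q: "v \<in> proper_multiples \<Longrightarrow> v \<notin> Q"
  using not_prime_mult Q_prime unfolding proper_multiples_def by blast

text \<open>A prime loses one edge for each of its proper multiples. A proper multiple lies in a
  single star, since it determines its prime, and loses one edge.\<close>

lemma card_stars:
  "card (stars `` {v}) = (if v \<in> Q then n div v - 1 else 0)
    + of_bool (v \<in> proper_multiples)"
proof -
  consider "v \<in> Q" | j p where "v = j * p" "p \<in> Q" "2 \<le> j" "j \<le> n div p"
    | "v \<notin> Q" "v \<notin> proper_multiples"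
    by (auto simp: proper_multiples_def)
  then show ?thesis
  proof cases
    case 1
    then have "stars `` {v} = (\<lambda>j. j * v) ` {2..n div v}"
      using proper_multiples_not_Q[of v] by (auto simp: stars_def proper_multiples_def)
    moreover have "inj_on (\<lambda>j. j * v) {2..n div v}"
      using Q_gt[OF 1] by (auto simp: inj_on_def)
    ultimately have "card (stars `` {v}) = n div v - 1" by (simp add: card_image)
    then show ?thesis using 1 proper_multiples_not_Q by auto
  next
    case 2
    then have mem: "v \<in> proper_multiples" by (auto simp: proper_multiples_def)
    have unique: "q = p" if "v = i * q" "q \<in> Q" "2 \<le> i" "i \<le> n div q" for i q
      using Q_multiple_eqD[of j p i q] that 2 by auto
    have "stars `` {v} = {p}"
    proof
      show "stars `` {v} \<subseteq> {p}"
        using unique proper_multiples_not_Q[OF mem] by (auto simp: stars_def)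
      show "{p} \<subseteq> stars `` {v}"
        using 2 by (auto simp: stars_def)
    qed
    then show ?thesis using mem proper_multiples_not_Q[OF mem] by simp
  next
    case 3
    then have "stars `` {v} = {}"
      by (auto simp: stars_def proper_multiples_def)
    then show ?thesis using 3 by simp
  qed
qed

text \<open>Injectivity of \<open>companion\<close> makes these edges a matching, which later limits
  an independent set to two composite multiples of a prime.\<close>

lemma companion_edges_unique:
  "(x, y) \<in> companion_edges \<Longrightarrow> (x, z) \<in> companion_edges \<Longrightarrow> y = z"
  using companion_inj by (auto simp: companion_edges_def dest: inj_onD)

lemma card_companion_edges:
  "card (companion_edges `` {v}) = of_bool (v \<in> companion ` Q_even)"
proof (cases "v \<in> companion ` Q_even")
  case True
  then obtain p where "p \<in> Q_even" "v = companion p" by auto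
  then have mem: "(v, companion (\<sigma> p)) \<in> companion_edges" by (auto simp: companion_edges_def)
  then have "companion_edges `` {v} = {companion (\<sigma> p)}"
    using companion_edges_unique by blast
  then show ?thesis using True by simp
next
  case False
  then have "companion_edges `` {v} = {}" by (auto simp: companion_edges_def)
  then show ?thesis using False by simp
qed

text \<open>A clique of size \<open>n div v\<close> returns exactly what the star at
  \<open>v\<close> takes away.\<close>

lemma card_block_edges: "card (block_edges `` {v}) = (if v \<in> Q then n div v - 1 else 0)"
proof (cases "v \<in> Q")
  case True
  then have "block_edges `` {v} = {q \<in> Q. n div q = n div v \<and> b q = b v} - {v}"
    by (auto simp: block_edges_def)
  then show ?thesis using card_block[OF True] True by (simp add: card_Diff_singleton_if)
next
  case False
  then have "block_edges `` {v} = {}" by (auto simp: block_edges_def)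
  then show ?thesis using False by simp
qed

lemma card_step_edges:
  "card (step_edges `` {v}) = of_bool (v \<in> (\<lambda>(j, p). j * p) ` step_index)
    + of_bool (v \<in> (\<lambda>(j, p). (j + 1) * \<sigma> p) ` step_index)"
  unfolding step_edges_def
proof (rule card_Image_sym_pairs)
  show "inj_on (\<lambda>(j, p). j * p) step_index"
  proof (rule inj_onI, clarify)
    fix j p i q
    assume "(j, p) \<in> step_index" "(i, q) \<in> step_index" and eq: "j * p = i * q"
    then show "j = i \<and> p = q"
      by (intro Q_multiple_eqD[OF eq]) (auto simp: step_index_def)
  qed
  show "inj_on (\<lambda>(j, p). (j + 1) * \<sigma> p) step_index"
  proof (rule inj_onI, clarify)
    fix j p i q
    assume "(j, p) \<in> step_index" "(i, q) \<in> step_index" and eq: "(j + 1) * \<sigma> p = (i + 1) * \<sigma> q"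
    then have jp: "p \<in> Q" "j + 1 \<le> n div p" "q \<in> Q" "i + 1 \<le> n div q"
      by (auto simp: step_index_def)
    then have "j + 1 = i + 1 \<and> \<sigma> p = \<sigma> q"
      by (intro Q_multiple_eqD[OF eq]) (auto simp: \<sigma>_in \<sigma>_div)
    then show "j = i \<and> p = q" using jp \<sigma>_inj by (auto dest: inj_onD)
  qed
  show "(\<lambda>(j, p). j * p) ` step_index \<inter> (\<lambda>(j, p). (j + 1) * \<sigma> p) ` step_index = {}"
    by (rule even_odd_images_disjoint) (auto simp: step_index_def Q_odd \<sigma>_in)
qed

text \<open>Since \<open>\<sigma>\<close> permutes \<open>Q_even\<close>, every companion is hit
  once and recovers the edge lost in \<open>companion_edges\<close>.\<close>

lemma card_top_edges:
  "card (top_edges `` {v}) = of_bool (v \<in> (\<lambda>p. (n div p) * p) ` Q_even)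
    + of_bool (v \<in> companion ` Q_even)"
proof -
  have "card (top_edges `` {v}) = of_bool (v \<in> (\<lambda>p. (n div p) * p) ` Q_even)
    + of_bool (v \<in> (\<lambda>p. companion (\<sigma> p)) ` Q_even)"
    unfolding top_edges_def
  proof (rule card_Image_sym_pairs)
    show "inj_on (\<lambda>p. (n div p) * p) Q_even"
    proof (rule inj_onI)
      fix p q assume pq: "p \<in> Q_even" "q \<in> Q_even" and eq: "n div p * p = n div q * q"
      then have "n div p = n div q \<and> p = q"
        using Q_even_ge[of p] Q_even_ge[of q] by (intro Q_multiple_eqD[OF eq]) (auto simp: Q_even_in)
      then show "p = q" by simp
    qed
    show "inj_on (\<lambda>p. companion (\<sigma> p)) Q_even"
    proof (rule inj_onI)
      fix p q assume pq: "p \<in> Q_even" "q \<in> Q_even" "companion (\<sigma> p) = companion (\<sigma> q)"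
      then have "\<sigma> p = \<sigma> q" using inj_onD[OF companion_inj] \<sigma>_Q_even by blast
      then show "p = q" using inj_onD[OF \<sigma>_inj] Q_even_in pq by blast
    qed
    show "(\<lambda>p. (n div p) * p) ` Q_even \<inter> (\<lambda>p. companion (\<sigma> p)) ` Q_even = {}"
      by (rule even_odd_images_disjoint) (auto simp: Q_even_even companion_odd \<sigma>_Q_even)
  qed
  moreover have "(\<lambda>p. companion (\<sigma> p)) ` Q_even = companion ` Q_even"
    using \<sigma>_image_Q_even by (metis image_image)
  ultimately show ?thesis by simp
qed

text \<open>Sort \<open>j * p\<close> by \<open>j\<close>: even and below the quotient, odd, or even
  and equal to the quotient. The sum of indicators records both that the three families cover the
  proper multiples and that they are disjoint.\<close>

lemma proper_multiples_cases:
  "of_bool (v \<in> (\<lambda>(j, p). j * p) ` step_index)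
    + of_bool (v \<in> (\<lambda>(j, p). (j + 1) * \<sigma> p) ` step_index)
    + of_bool (v \<in> (\<lambda>p. (n div p) * p) ` Q_even) = (of_bool (v \<in> proper_multiples) :: nat)"
  (is "of_bool (v \<in> ?X) + of_bool (v \<in> ?Y) + of_bool (v \<in> ?Z) = _")
proof (cases "v \<in> proper_multiples")
  case True
  then obtain j p where v: "v = j * p" and p: "p \<in> Q" "2 \<le> j" "j \<le> n div p"
    by (auto simp: proper_multiples_def)
  have X: "v \<in> ?X \<longleftrightarrow> even j \<and> j + 1 \<le> n div p"
  proof
    assume "v \<in> ?X"
    then obtain i q where "v = i * q" "(i, q) \<in> step_index" by auto
    then show "even j \<and> j + 1 \<le> n div p"
      using Q_multiple_eqD[of j p i q] v p by (auto simp: step_index_def)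
  next
    assume "even j \<and> j + 1 \<le> n div p"
    then show "v \<in> ?X" using v p by (auto simp: step_index_def intro!: image_eqI[of _ _ "(j, p)"])
  qed
  have Y: "v \<in> ?Y \<longleftrightarrow> odd j"
  proof
    assume "v \<in> ?Y"
    then obtain i q where "v = (i + 1) * \<sigma> q" "(i, q) \<in> step_index" by auto
    then show "odd j"
      using Q_multiple_eqD[of j p "i + 1" "\<sigma> q"] v p by (auto simp: step_index_def \<sigma>_in \<sigma>_div)
  next
    assume "odd j"
    \<comment> \<open>Surjectivity of \<open>\<sigma>\<close> makes \<open>(j - 1, q)\<close> the
      index whose odd endpoint is \<open>v\<close>.\<close>
    obtain q where q: "q \<in> Q" "p = \<sigma> q" using \<sigma>_bij p by (auto simp: bij_betw_def)
    have "(j - 1, q) \<in> step_index"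
      using q p \<open>odd j\<close> \<sigma>_div[OF q(1)] by (auto simp: step_index_def elim!: oddE)
    moreover have "v = (j - 1 + 1) * \<sigma> q" using v p q by simp
    ultimately show "v \<in> ?Y" by (intro image_eqI[of _ _ "(j - 1, q)"]) simp_all
  qed
  have Z: "v \<in> ?Z \<longleftrightarrow> even j \<and> j = n div p"
  proof
    assume "v \<in> ?Z"
    then obtain q where q: "v = (n div q) * q" "q \<in> Q_even" by auto
    then have "j = n div q \<and> p = q"
      using v p Q_even_ge[OF q(2)] Q_even_in[OF q(2)] by (intro Q_multiple_eqD) auto
    then show "even j \<and> j = n div p" using Q_even_even[OF q(2)] by simp
  next
    assume "even j \<and> j = n div p"
    then show "v \<in> ?Z" using v p by (auto simp: Q_even_def)
  qed
  show ?thesis using X Y Z True p(3) by auto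
next
  case False
  have "v \<notin> ?X" using False by (auto simp: proper_multiples_def step_index_def)
  moreover have "v \<notin> ?Y"
  proof
    assume "v \<in> ?Y"
    then obtain i q where "v = (i + 1) * \<sigma> q" "(i, q) \<in> step_index" by auto
    moreover from this have "\<sigma> q \<in> Q" "2 \<le> i + 1" "i + 1 \<le> n div \<sigma> q"
      by (auto simp: step_index_def \<sigma>_in \<sigma>_div)
    ultimately have "v \<in> proper_multiples"
      unfolding proper_multiples_def by blast
    with False show False by simp
  qed
  moreover have "v \<notin> ?Z"
    using False Q_even_in Q_even_ge unfolding proper_multiples_def by blast
  ultimately show ?thesis using False by simp
qed

section \<open>Disjointness of the edge families\<close>

lemma stars_companion_edges_disjoint: "stars \<inter> companion_edges = {}"
proof -
  have "prime x \<or> prime y" if "(x, y) \<in> stars" for x y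
    using that Q_prime by (auto simp: stars_def)
  moreover have "\<not> prime x \<and> \<not> prime y" if "(x, y) \<in> companion_edges" for x y
    using that companion_not_prime \<sigma>_Q_even by (auto simp: companion_edges_def)
  ultimately show ?thesis by fast
qed

lemma not_prime_step_edges: "(x, y) \<in> step_edges \<Longrightarrow> \<not> prime x"
  using not_prime_mult \<sigma>_in by (auto simp: step_edges_def sym_pairs_def step_index_def simp del: mult_Suc)

lemma not_prime_top_edges: "(x, y) \<in> top_edges \<Longrightarrow> \<not> prime x"
  using not_prime_mult Q_even_in Q_even_ge companion_not_prime \<sigma>_Q_even
  by (auto simp: top_edges_def sym_pairs_def)

lemma block_edges_disjoint: "block_edges \<inter> (step_edges \<union> top_edges) = {}"
  using not_prime_step_edges not_prime_top_edges Q_prime unfolding block_edges_def by blast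

text \<open>Every top edge has an end \<open>(n div p) * p\<close>, which no step edge meets. The
  companion end would not do: \<open>(k - 1) * p\<close> with \<open>k \<ge> 4\<close> is itself an
  end of a step edge.\<close>

lemma step_edges_top_edges_disjoint: "step_edges \<inter> top_edges = {}"
proof -
  let ?XY = "(\<lambda>(j, p). j * p) ` step_index \<union> (\<lambda>(j, p). (j + 1) * \<sigma> p) ` step_index"
  let ?Z = "(\<lambda>p. (n div p) * p) ` Q_even"
  have disj: "v \<notin> ?Z" if "v \<in> ?XY" for v
  proof
    assume "v \<in> ?Z"
    then show False using proper_multiples_cases[of v] that
      by (auto simp: of_bool_def split: if_splits)
  qed
  have step: "x \<in> ?XY" "y \<in> ?XY" if "(x, y) \<in> step_edges" for x y
    using that unfolding step_edges_def sym_pairs_def by blast+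
  have top: "x \<in> ?Z \<or> y \<in> ?Z" if "(x, y) \<in> top_edges" for x y
    using that unfolding top_edges_def sym_pairs_def by blast
  have False if "(x, y) \<in> step_edges" "(x, y) \<in> top_edges" for x y
    using top[OF that(2)] disj[OF step(1)[OF that(1)]] disj[OF step(2)[OF that(1)]] by iprover
  then show ?thesis by auto
qed

section \<open>Removed edges are present, added edges are absent\<close>

lemma gcd_graph_iff:
  "(x, y) \<in> parcs (gcd_graph n) \<longleftrightarrow> x \<in> {2..n} \<and> y \<in> {2..n} \<and> x \<noteq> y \<and> gcd x y > 1"
  by (simp add: gcd_graph_def)

lemma sym_gcd_graph: "sym (parcs (gcd_graph n))"
  by (auto intro!: symI simp: gcd_graph_iff gcd.commute)

lemma Q_range: "p \<in> Q \<Longrightarrow> p \<in> {2..n}"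
  using Q_gt[of p] Q_le[of p] by auto

lemma multiple_range:
  assumes "p \<in> Q" "1 \<le> j" "j \<le> n div p" shows "j * p \<in> {2..n}"
  using Q_range[OF assms(1)] mult_le_n[OF assms(3)] assms(2)
  by (metis atLeastAtMost_iff le_trans mult_le_mono1 nat_mult_1)

lemma sym_stars: "sym stars"
  by (rule symI) (auto simp: stars_def)

lemma sym_companion_edges: "sym companion_edges"
  by (rule symI) (auto simp: companion_edges_def \<sigma>_\<sigma> \<sigma>_Q_even intro!: image_eqI[of _ _ "\<sigma> _"])

lemma sym_block_edges: "sym block_edges"
  by (rule symI) (auto simp: block_edges_def)

lemma stars_subset: "stars \<subseteq> parcs (gcd_graph n)"
proof -
  have "(p, j * p) \<in> parcs (gcd_graph n)" if "p \<in> Q" "2 \<le> j" "j \<le> n div p" for j p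
    using that Q_range[of p] multiple_range[of p j] by (auto simp: gcd_graph_iff)
  then show ?thesis
    using sym_gcd_graph unfolding stars_def by (auto dest: symD)
qed

lemma companion_edges_subset: "companion_edges \<subseteq> parcs (gcd_graph n)"
proof -
  have "(companion p, companion (\<sigma> p)) \<in> parcs (gcd_graph n)" if p: "p \<in> Q_even" for p
  proof -
    note \<sigma>p = \<sigma>_Q_even[OF p]
    have "companion p \<noteq> companion (\<sigma> p)"
      using inj_onD[OF companion_inj _ p \<sigma>p] \<sigma>_neq[OF Q_even_in[OF p] Q_even_ge[OF p]] by metis
    then show ?thesis
      unfolding gcd_graph_iff
      using companion_range p \<sigma>p gcd_companion[OF p \<sigma>p] \<sigma>_div[OF Q_even_in[OF p]] by simp
  qed
  then show ?thesis by (auto simp: companion_edges_def)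
qed

text \<open>Coprimality makes the added edges new, and loop-free because the ends are at least 2.
  Block edges join distinct primes; step edges join consecutive cofactors of the distinct primes
  \<open>p\<close> and \<open>\<sigma> p\<close>.\<close>

lemma added_edges:
  assumes "(x, y) \<in> block_edges \<union> step_edges \<union> top_edges"
  shows "x \<in> {2..n}" "y \<in> {2..n}" "coprime x y"
proof -
  let ?C = "{(x, y). x \<in> {2..n} \<and> y \<in> {2..n} \<and> coprime x y}"
  have sym: "sym_pairs f g I \<subseteq> ?C"
    if "\<And>i. i \<in> I \<Longrightarrow> f i \<in> {2..n} \<and> g i \<in> {2..n} \<and> coprime (f i) (g i)" for f g :: "'i \<Rightarrow> nat" and I
    using that by (auto simp: sym_pairs_def coprime_commute)
  have "block_edges \<subseteq> ?C"
    using Q_range Q_prime by (auto simp: block_edges_def intro!: primes_coprime)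
  moreover have "step_edges \<subseteq> ?C"
    unfolding step_edges_def
  proof (rule sym)
    fix i assume i: "i \<in> step_index"
    obtain j p where [simp]: "i = (j, p)" by (cases i)
    have jp: "p \<in> Q" "2 \<le> j" "j + 1 \<le> n div p" using i by (auto simp: step_index_def)
    have \<sigma>p: "\<sigma> p \<in> Q" "n div \<sigma> p = n div p" "p \<noteq> \<sigma> p"
      using jp \<sigma>_in \<sigma>_div \<sigma>_neq[of p] by auto
    have "coprime (j * p) ((j + 1) * \<sigma> p)"
      by (rule coprime_multiples) (use jp \<sigma>p in auto)
    moreover have "j * p \<in> {2..n}" "(j + 1) * \<sigma> p \<in> {2..n}"
      using jp \<sigma>p by (auto intro!: multiple_range simp del: mult_Suc atLeastAtMost_iff)
    ultimately show "(case i of (j, p) \<Rightarrow> j * p) \<in> {2..n} \<and>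
        (case i of (j, p) \<Rightarrow> (j + 1) * \<sigma> p) \<in> {2..n} \<and>
        coprime (case i of (j, p) \<Rightarrow> j * p) (case i of (j, p) \<Rightarrow> (j + 1) * \<sigma> p)"
      by simp
  qed
  moreover have "top_edges \<subseteq> ?C"
    unfolding top_edges_def
  proof (rule sym)
    fix p assume p: "p \<in> Q_even"
    note \<sigma>p = \<sigma>_Q_even[OF p]
    have "p \<noteq> \<sigma> p" "n div \<sigma> p = n div p"
      using \<sigma>_neq[OF Q_even_in[OF p] Q_even_ge[OF p]] \<sigma>_div[OF Q_even_in[OF p]] by auto
    then show "n div p * p \<in> {2..n} \<and> companion (\<sigma> p) \<in> {2..n}
        \<and> coprime (n div p * p) (companion (\<sigma> p))"
      using multiple_range[OF Q_even_in[OF p], of "n div p"] Q_even_ge[OF p]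
        companion_range[OF \<sigma>p] coprime_top_companion[OF p \<sigma>p] by simp
  qed
  ultimately have "(x, y) \<in> ?C" using assms by blast
  then show "x \<in> {2..n}" "y \<in> {2..n}" "coprime x y" by auto
qed

lemma finite_gcd_graph: "finite (parcs (gcd_graph n))"
  by (rule finite_subset[of _ "{2..n} \<times> {2..n}"]) (auto simp: gcd_graph_iff)

lemma finite_added: "finite (block_edges \<union> step_edges \<union> top_edges)"
proof (rule finite_subset)
  show "block_edges \<union> step_edges \<union> top_edges \<subseteq> {2..n} \<times> {2..n}"
    by (rule subrelI, rule SigmaI) (fact added_edges)+
qed simp

lemma added_disjoint: "(block_edges \<union> step_edges \<union> top_edges) \<inter> parcs (gcd_graph n) = {}"
proof -
  have "(x, y) \<notin> parcs (gcd_graph n)" if "(x, y) \<in> block_edges \<union> step_edges \<union> top_edges" for x y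
    using added_edges(3)[OF that] by (simp add: gcd_graph_iff coprime_iff_gcd_eq_1)
  then show ?thesis by (rule disjoint_relI)
qed

text \<open>Block edges offset the stars at the primes, step and top edges offset them at the proper
  multiples, and top edges offset the companion edges at the companions.\<close>

lemma card_removed_eq_card_added:
  "card ((stars \<union> companion_edges) `` {v}) = card ((block_edges \<union> step_edges \<union> top_edges) `` {v})"
proof -
  have "finite stars" "finite companion_edges"
    using stars_subset companion_edges_subset finite_gcd_graph finite_subset by blast+
  then have "card ((stars \<union> companion_edges) `` {v}) = card (stars `` {v}) + card (companion_edges `` {v})"
    using stars_companion_edges_disjoint by (rule card_Image_Un_disjoint)
  moreover have "card ((block_edges \<union> (step_edges \<union> top_edges)) `` {v})
     = card (block_edges `` {v}) + (card (step_edges `` {v}) + card (top_edges `` {v}))"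
    using finite_added block_edges_disjoint step_edges_top_edges_disjoint
    by (simp add: card_Image_Un_disjoint)
  ultimately show ?thesis
    using proper_multiples_cases[of v]
    unfolding card_stars card_companion_edges card_block_edges card_step_edges card_top_edges Un_assoc
    by linarith
qed

lemma vertex_degree_switched: "vertex_degree switched_graph v = vertex_degree (gcd_graph n) v"
  unfolding vertex_degree_eq_card_Image switched_graph_def pair_pre_digraph.select_convs
  using finite_gcd_graph stars_subset companion_edges_subset finite_added added_disjoint
    card_removed_eq_card_added
  by (intro card_Image_Diff_Un) auto

lemma pair_graph_switched: "pair_graph switched_graph"
proof -
  let ?A = "block_edges \<union> step_edges \<union> top_edges" and ?R = "stars \<union> companion_edges"
  have arcs: "(x, y) \<in> parcs switched_graph \<Longrightarrow> x \<in> {2..n} \<and> y \<in> {2..n} \<and> x \<noteq> y" for x y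
    using added_edges[of x y] by (auto simp: switched_graph_def gcd_graph_iff)
  have "sym ?A"
    unfolding step_edges_def top_edges_def
    by (intro sym_Un sym_block_edges sym_sym_pairs)
  moreover have "sym ?R"
    using sym_stars sym_companion_edges by (intro sym_Un)
  ultimately have "sym (parcs switched_graph)"
    using sym_gcd_graph unfolding switched_graph_def sym_def pair_pre_digraph.select_convs
    by blast
  moreover have "finite (parcs switched_graph)"
    using finite_gcd_graph finite_added by (auto simp: switched_graph_def)
  moreover have "pverts switched_graph = {2..n}" by (simp add: switched_graph_def)
  ultimately show ?thesis
    using arcs by unfold_locales (auto simp: symmetric_def)
qed

section \<open>Independent sets of the switched graph\<close>

lemma independent_removed:
  assumes "independent_set switched_graph S" "x \<in> S" "y \<in> S" "x \<noteq> y" "gcd x y > 1"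
  shows "(x, y) \<in> stars \<union> companion_edges"
proof -
  have "S \<subseteq> {2..n}" "(x, y) \<notin> parcs switched_graph"
    using assms by (auto simp: independent_set_def switched_graph_def)
  moreover have "(x, y) \<in> parcs (gcd_graph n)"
    using calculation assms by (auto simp: gcd_graph_iff)
  ultimately show ?thesis by (auto simp: switched_graph_def)
qed

text \<open>Members sharing \<open>q\<close> are adjacent in the gcd graph, so their edge was
  removed. Between composites it is no star edge, hence a companion edge, and the matching leaves
  \<open>x\<close> at most one partner.\<close>

lemma card_independent_composite_multiples:
  assumes S: "independent_set switched_graph S" and q: "prime q"
  shows "card {x \<in> S. \<not> prime x \<and> q dvd x} \<le> 2"
proof (cases "{x \<in> S. \<not> prime x \<and> q dvd x} = {}")
  case False
  then obtain x where x: "x \<in> S" "\<not> prime x" "q dvd x" by auto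
  have removed: "(x, y) \<in> companion_edges"
    if y: "y \<in> S" "\<not> prime y" "q dvd y" "y \<noteq> x" for y
  proof -
    have "x \<ge> 2" using S x by (auto simp: independent_set_def switched_graph_def)
    then have "q \<le> gcd x y" using x y by (intro dvd_imp_le) auto
    then have "gcd x y > 1" using prime_gt_1_nat[OF q] by simp
    then have "(x, y) \<in> stars \<union> companion_edges"
      using independent_removed[OF S x(1) y(1)] y(4) by auto
    moreover have "(x, y) \<notin> stars"
      using x(2) y(2) Q_prime by (auto simp: stars_def)
    ultimately show ?thesis by simp
  qed
  have "\<exists>z. {x \<in> S. \<not> prime x \<and> q dvd x} \<subseteq> {x, z}"
  proof (cases "\<exists>z. z \<in> S \<and> \<not> prime z \<and> q dvd z \<and> z \<noteq> x")
    case True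
    then obtain z where "z \<in> S" "\<not> prime z" "q dvd z" "z \<noteq> x" by auto
    then have "{x \<in> S. \<not> prime x \<and> q dvd x} \<subseteq> {x, z}"
      using companion_edges_unique removed by blast
    then show ?thesis by blast
  qed auto
  then obtain z where "{x \<in> S. \<not> prime x \<and> q dvd x} \<subseteq> {x, z}" by auto
  then have "card {x \<in> S. \<not> prime x \<and> q dvd x} \<le> card {x, z}" by (intro card_mono) auto
  also have "\<dots> \<le> 2" by (simp add: card_insert_if)
  finally show ?thesis .
qed (metis card.empty zero_le)

lemma composite_prime_factor_le_sqrt:
  assumes "\<not> prime x" "2 \<le> x"
  obtains q :: nat where "prime q" "q dvd x" "q * q \<le> x"
proof -
  obtain m where "m dvd x" "m \<noteq> 1" "m \<noteq> x"
    using assms by (auto simp: prime_nat_iff)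
  then obtain c where c: "x = m * c" by (auto elim: dvdE)
  have pos: "m > 0" "c > 0" using c assms(2) by (auto intro: Nat.gr0I)
  have "c \<noteq> 1" using c \<open>m \<noteq> x\<close> by auto
  define a where "a = min m c"
  have "a \<noteq> 1" using \<open>c \<noteq> 1\<close> \<open>m \<noteq> 1\<close> by (auto simp: a_def min_def)
  moreover have "a dvd x" "a * a \<le> x" and "a > 0"
    using c pos by (auto simp: a_def min_def)
  moreover obtain q where q: "prime q" "q dvd a" using prime_factor_nat \<open>a \<noteq> 1\<close> by blast
  moreover have "q \<le> a" using dvd_imp_le[OF q(2) \<open>a > 0\<close>] .
  then have "q * q \<le> a * a" by (intro mult_le_mono)
  ultimately show ?thesis using that[of q] by (meson dvd_trans le_trans)
qed

text \<open>Every composite up to \<open>n\<close> has a prime factor up to \<open>sqrt n\<close>,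
  and each such prime accounts for at most two members.\<close>

lemma card_independent_composites:
  assumes S: "independent_set switched_graph S"
  shows "card {x \<in> S. \<not> prime x} \<le> 2 * prime_pi (sqrt (real n))"
proof -
  define T where "T = {q. prime q \<and> real q \<le> sqrt (real n)}"
  have T_iff: "q \<in> T \<longleftrightarrow> prime q \<and> q * q \<le> n" for q
  proof -
    have "real q \<le> sqrt (real n) \<longleftrightarrow> sqrt (real (q * q)) \<le> sqrt (real n)" by simp
    also have "\<dots> \<longleftrightarrow> q * q \<le> n" by (simp only: real_sqrt_le_iff of_nat_le_iff)
    finally show ?thesis by (simp add: T_def)
  qed
  have "q \<le> n" if "q \<in> T" for q
    using that le_square[of q] unfolding T_iff by linarith
  then have fin: "finite T" by (intro finite_subset[of T "{..n}"]) auto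
  have Sn: "S \<subseteq> {2..n}" using S by (auto simp: independent_set_def switched_graph_def)
  then have finS: "finite S" using finite_subset by blast
  have "{x \<in> S. \<not> prime x} \<subseteq> (\<Union>q\<in>T. {x \<in> S. \<not> prime x \<and> q dvd x})"
  proof
    fix x assume x: "x \<in> {x \<in> S. \<not> prime x}"
    then have "\<not> prime x" "2 \<le> x" "x \<le> n" using Sn by auto
    then obtain q where "prime q" "q dvd x" "q * q \<le> x"
      by (elim composite_prime_factor_le_sqrt)
    then have "q \<in> T" using \<open>x \<le> n\<close> by (simp add: T_iff)
    then show "x \<in> (\<Union>q\<in>T. {x \<in> S. \<not> prime x \<and> q dvd x})"
      using x \<open>q dvd x\<close> by blast
  qed
  then have "card {x \<in> S. \<not> prime x} \<le> card (\<Union>q\<in>T. {x \<in> S. \<not> prime x \<and> q dvd x})"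
    using fin finS by (intro card_mono) auto
  also have "\<dots> \<le> (\<Sum>q\<in>T. card {x \<in> S. \<not> prime x \<and> q dvd x})"
    by (rule card_UN_le[OF fin])
  also have "\<dots> \<le> (\<Sum>q\<in>T. 2)"
    using card_independent_composite_multiples[OF S] by (intro sum_mono) (auto simp: T_iff)
  finally show ?thesis by (simp add: prime_pi_def T_def)
qed

text \<open>Distinct primes of one block are joined by a clique edge, so an independent set contains
  at most one of them.\<close>

lemma inj_on_block_independent:
  assumes "independent_set switched_graph S"
  shows "inj_on (\<lambda>p. (n div p, b p)) (S \<inter> Q)"
proof (rule inj_onI, rule ccontr)
  fix p q assume pq: "p \<in> S \<inter> Q" "q \<in> S \<inter> Q" "(n div p, b p) = (n div q, b q)" "p \<noteq> q"
  have "(p, q) \<in> block_edges" unfolding block_edges_def mem_Collect_eq case_prod_conv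
    using pq by (metis IntD2 prod.inject)
  then have "(p, q) \<in> parcs switched_graph"
    by (simp add: switched_graph_def)
  moreover have "(p, q) \<notin> parcs switched_graph"
    using assms pq(1,2) unfolding independent_set_def by blast
  ultimately show False by contradiction
qed

end

section \<open>The bound\<close>

lemma independence_number_le:
  assumes "finite (pverts G)" "\<And>S. independent_set G S \<Longrightarrow> card S \<le> m"
  shows "independence_number G \<le> m"
  unfolding independence_number_def
proof (rule Max.boundedI)
  have "{S. independent_set G S} \<subseteq> Pow (pverts G)" by (auto simp: independent_set_def)
  then show "finite (card ` {S. independent_set G S})"
    using assms(1) by (meson finite_Pow_iff finite_imageI finite_subset)
  have "independent_set G {}" by (simp add: independent_set_def)
  then show "card ` {S. independent_set G S} \<noteq> {}" by blast
qed (use assms(2) in auto)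

lemma ex_switched_graph:
  fixes n K :: nat
  assumes n: "n \<ge> 120" and K: "(K + 1)\<^sup>2 \<le> n"
  shows "\<exists>H :: nat pair_pre_digraph.
      pair_graph H \<and> pverts H = {2..n} \<and>
      (\<forall>v\<in>{2..n}. vertex_degree H v = vertex_degree (gcd_graph n) v) \<and>
      independence_number H \<le>
        (\<Sum>k = 1..K. prime_quotient_count k n div k)
        + prime_pi (real n / (real K + 1)) + 2 * prime_pi (sqrt (real n)) + K\<^sup>2"
proof -
  define P where "P k = {p. prime p \<and> p \<le> n \<and> n div p = k}" for k
  have finP: "finite (P k)" for k
    by (rule finite_subset[of _ "{..n}"]) (auto simp: P_def)
  have P_div: "n div p = k" if "p \<in> P k" for p k using that by (simp add: P_def)
  have "\<forall>k. \<exists>Q b \<sigma>. k \<ge> 1 \<longrightarrow> block_partition (P k) k Q b \<sigma>"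
    using ex_block_partition[OF finP] by blast
  then obtain Q' b' \<sigma>' where part: "\<And>k. k \<ge> 1 \<Longrightarrow> block_partition (P k) k (Q' k) (b' k) (\<sigma>' k)"
    by metis
  define Q where "Q = (\<Union>k\<in>{1..K}. Q' k)"
  \<comment> \<open>The classes \<open>P k\<close> are disjoint, so the choices for the various
    \<open>k\<close> are glued by reading \<open>k\<close> off as \<open>n div p\<close>.\<close>
  define b where "b p = b' (n div p) p" for p
  define \<sigma> where "\<sigma> p = \<sigma>' (n div p) p" for p
  have sub: "Q' k \<subseteq> P k" if "k \<ge> 1" for k
    using part[OF that] by (simp add: block_partition_def)
  have Q_iff: "p \<in> Q \<longleftrightarrow> n div p \<in> {1..K} \<and> p \<in> Q' (n div p)" for p
  proof
    assume "p \<in> Q"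
    then obtain k where k: "k \<in> {1..K}" "p \<in> Q' k" unfolding Q_def by blast
    then have "n div p = k" using sub[of k] P_div[of p k] by auto
    then show "n div p \<in> {1..K} \<and> p \<in> Q' (n div p)" using k by simp
  qed (auto simp: Q_def)
  have bij: "bij_betw (\<sigma>' k) (Q' k) (Q' k)" if "k \<ge> 1" for k
    using part[OF that] by (simp add: block_partition_def)
  have \<sigma>'_in: "\<sigma>' k p \<in> Q' k" if "k \<ge> 1" "p \<in> Q' k" for k p
    using bij[OF that(1)] that(2) by (auto simp: bij_betw_def)
  have \<sigma>_div: "n div \<sigma> p = n div p" if "p \<in> Q" for p
  proof -
    have k: "n div p \<ge> 1" "p \<in> Q' (n div p)" using that by (auto simp: Q_iff)
    then have "\<sigma> p \<in> P (n div p)"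
      unfolding \<sigma>_def using \<sigma>'_in[OF k] sub[OF k(1)] by blast
    then show ?thesis by (rule P_div)
  qed
  interpret prime_blocks n K Q b \<sigma>
  proof
    show "n \<ge> 120" "(K + 1)\<^sup>2 \<le> n" by fact+
  next
    fix p assume p: "p \<in> Q"
    then have k: "n div p \<ge> 1" "n div p \<le> K" "p \<in> Q' (n div p)" by (auto simp: Q_iff)
    note part_p = part[OF k(1), unfolded block_partition_def]
    show "prime p \<and> p \<le> n \<and> n div p \<le> K" using subsetD[OF sub[OF k(1)] k(3)] k(2) unfolding P_def by blast
    have "{q \<in> Q. n div q = n div p \<and> b q = b p} = {q \<in> Q' (n div p). b' (n div p) q = b' (n div p) p}"
      using k(1,2) P_div[OF subsetD[OF sub[OF k(1)]]] by (auto simp: Q_iff b_def)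
    then show "card {q \<in> Q. n div q = n div p \<and> b q = b p} = n div p"
      using part_p k(3) by simp
    show "n div \<sigma> p = n div p" by (rule \<sigma>_div[OF p])
    show "\<sigma> p \<noteq> p" if "n div p \<ge> 2" using part_p k(3) that by (simp add: \<sigma>_def)
    show "\<sigma> (\<sigma> p) = p" if "even (n div p)"
      using part_p k(3) that \<sigma>_div[OF p] by (simp add: \<sigma>_def)
  next
    have "inj_on \<sigma> Q"
    proof (rule inj_onI)
      fix p q assume pq: "p \<in> Q" "q \<in> Q" "\<sigma> p = \<sigma> q"
      then have eq: "n div p = n div q" using \<sigma>_div by metis
      have "inj_on (\<sigma>' (n div p)) (Q' (n div p))"
        using pq bij[of "n div p"] by (simp add: Q_iff bij_betw_def)
      then show "p = q" using pq eq by (auto simp: Q_iff \<sigma>_def dest: inj_onD)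
    qed
    moreover have "\<sigma> ` Q = Q"
    proof -
      have "\<sigma> ` Q' k = Q' k" if "k \<ge> 1" for k
      proof -
        have "\<sigma> ` Q' k = \<sigma>' k ` Q' k"
          using sub[OF that] P_div by (intro image_cong) (auto simp: \<sigma>_def)
        then show ?thesis using bij[OF that] by (simp add: bij_betw_def)
      qed
      then show ?thesis by (simp add: Q_def image_UN)
    qed
    ultimately show "bij_betw \<sigma> Q Q" by (simp add: bij_betw_def)
  qed
  have "card S \<le> (\<Sum>k = 1..K. prime_quotient_count k n div k)
        + prime_pi (real n / (real K + 1)) + 2 * prime_pi (sqrt (real n)) + K\<^sup>2"
    if S: "independent_set switched_graph S" for S
  proof -
    have Sn: "S \<subseteq> {2..n}" using S by (auto simp: independent_set_def switched_graph_def)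
    then have finS: "finite S" using finite_subset by blast
    let ?U = "\<Union>k\<in>{1..K}. P k - Q' k"
    let ?T = "{p. prime p \<and> real p \<le> real n / (real K + 1)}"
    have T_iff: "p \<in> ?T \<longleftrightarrow> prime p \<and> p * (K + 1) \<le> n" for p
    proof -
      have "real p \<le> real n / (real K + 1) \<longleftrightarrow> real (p * (K + 1)) \<le> real n"
        by (simp add: pos_le_divide_eq algebra_simps)
      then show ?thesis by (simp only: of_nat_le_iff mem_Collect_eq)
    qed
    have "p \<le> n" if "p \<in> ?T" for p
    proof -
      have "p \<le> p * (K + 1)" by simp
      also have "\<dots> \<le> n" using that unfolding T_iff by simp
      finally show ?thesis .
    qed
    then have finT: "finite ?T" by (intro finite_subset[of ?T "{..n}"]) auto
    \<comment> \<open>Four classes for the four terms of the bound: regrouped primes, leftover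
      primes, primes with quotient above \<open>K\<close>, and composites.\<close>
    have cover: "S \<subseteq> (S \<inter> Q) \<union> ?U \<union> ?T \<union> {x \<in> S. \<not> prime x}"
    proof
      fix x assume x: "x \<in> S"
      then have xn: "2 \<le> x" "x \<le> n" using Sn by auto
      show "x \<in> (S \<inter> Q) \<union> ?U \<union> ?T \<union> {x \<in> S. \<not> prime x}"
      proof (cases "prime x \<and> n div x \<le> K")
        case True
        have "n div x \<ge> 1" using xn by (simp add: Suc_leI div_greater_zero_iff)
        then have "n div x \<in> {1..K}" "x \<in> P (n div x)"
          using True xn by (auto simp: P_def)
        then show ?thesis using x Q_iff[of x] by blast
      next
        case False
        have "x * (K + 1) \<le> n" if "K < n div x"
          using that by (metis Suc_eq_plus1 Suc_leI le_trans mult_le_mono2 times_div_less_eq_dividend)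
        then have "\<not> prime x \<or> x \<in> ?T" using False unfolding T_iff by auto
        then show ?thesis using x by blast
      qed
    qed
    \<comment> \<open>Counting block labels instead of primes yields the floors.\<close>
    have "card (S \<inter> Q) \<le> card (SIGMA k:{1..K}. {..<card (P k) div k})"
    proof (rule card_inj_on_le[OF inj_on_block_independent[OF S]])
      show "(\<lambda>p. (n div p, b p)) ` (S \<inter> Q) \<subseteq> (SIGMA k:{1..K}. {..<card (P k) div k})"
        using part by (fastforce simp: Q_iff b_def block_partition_def)
    qed auto
    also have "\<dots> = (\<Sum>k = 1..K. prime_quotient_count k n div k)"
      by (simp add: P_def prime_quotient_count_def)
    finally have 1: "card (S \<inter> Q) \<le> (\<Sum>k = 1..K. prime_quotient_count k n div k)" .
    have "card ?U \<le> (\<Sum>k\<in>{1..K}. card (P k - Q' k))"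
      by (rule card_UN_le) simp
    \<comment> \<open>For each of the \<open>K\<close> quotients fewer than \<open>k \<le> K\<close>
      primes are left over.\<close>
    also have "\<dots> \<le> (\<Sum>k\<in>{1..K}. K)"
    proof (rule sum_mono)
      fix k assume k: "k \<in> {1..K}"
      then have "card (P k - Q' k) < k" using part[of k] by (simp add: block_partition_def)
      then show "card (P k - Q' k) \<le> K" using k by simp
    qed
    finally have 2: "card ?U \<le> K\<^sup>2" by (simp add: power2_eq_square)
    have "card S \<le> card ((S \<inter> Q) \<union> ?U \<union> ?T \<union> {x \<in> S. \<not> prime x})"
      using cover finT finS finP by (intro card_mono) auto
    also have "\<dots> \<le> card (S \<inter> Q) + card ?U + card ?T + card {x \<in> S. \<not> prime x}"
      by (meson add_le_mono1 card_Un_le le_trans)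
    finally show ?thesis
      using 1 2 card_independent_composites[OF S] unfolding prime_pi_def by linarith
  qed
  then have "independence_number switched_graph \<le> (\<Sum>k = 1..K. prime_quotient_count k n div k)
        + prime_pi (real n / (real K + 1)) + 2 * prime_pi (sqrt (real n)) + K\<^sup>2"
    by (intro independence_number_le) (simp add: switched_graph_def)
  then show ?thesis
    using pair_graph_switched vertex_degree_switched
    by (intro exI[of _ switched_graph]) (simp add: switched_graph_def)
qed

section \<open>Growth of the cutoff\<close>

text \<open>As \<beta> < 1/2, the cutoff is eventually at most \<open>exp (sqrt (ln n))\<close>,
  whose square grows more slowly than \<open>n\<close>.\<close>

lemma eventually_exp_ln_powr_square_le:
  fixes \<beta> :: real
  assumes "\<beta> < 1 / 2"
  shows "\<forall>\<^sub>F n :: nat in at_top. (nat \<lfloor>exp (ln (real n) powr \<beta>)\<rfloor> + 1)\<^sup>2 \<le> n"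
proof -
  have "\<forall>\<^sub>F n :: nat in at_top. (exp (sqrt (ln (real n))) + 1)\<^sup>2 \<le> real n"
    by real_asymp
  \<comment> \<open>With base at least 1 the power is monotone in its exponent, so \<beta> may be
    replaced by 1/2.\<close>
  moreover have "\<forall>\<^sub>F n :: nat in at_top. ln (real n) \<ge> 1"
    by real_asymp
  ultimately show ?thesis
  proof eventually_elim
    case (elim n)
    define K where "K = nat \<lfloor>exp (ln (real n) powr \<beta>)\<rfloor>"
    have "ln (real n) powr \<beta> \<le> ln (real n) powr (1 / 2)"
      using assms elim(2) by (intro powr_mono) auto
    also have "\<dots> = sqrt (ln (real n))"
      using elim(2) by (simp add: powr_half_sqrt)
    finally have "exp (ln (real n) powr \<beta>) \<le> exp (sqrt (ln (real n)))" by simp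
    moreover have "real K \<le> exp (ln (real n) powr \<beta>)"
      unfolding K_def by (simp add: of_nat_floor)
    ultimately have "real K \<le> exp (sqrt (ln (real n)))" by linarith
    then have "(real K + 1)\<^sup>2 \<le> (exp (sqrt (ln (real n))) + 1)\<^sup>2"
      by (intro power_mono) auto
    with elim(1) have "(real K + 1)\<^sup>2 \<le> real n" by linarith
    then have "real ((K + 1)\<^sup>2) \<le> real n" by (simp add: add.commute)
    then show ?case unfolding K_def of_nat_le_iff .
  qed
qed

theorem lemma7:
  fixes \<beta> :: real
  assumes "0 < \<beta>" and "\<beta> < 1 / 2"
  shows "\<forall>\<^sub>F n :: nat in at_top.
    let K = nat \<lfloor>exp (ln (real n) powr \<beta>)\<rfloor> in
    \<exists>H :: nat pair_pre_digraph.
      pair_graph H \<and> pverts H = {2..n} \<and>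
      (\<forall>v\<in>{2..n}. vertex_degree H v = vertex_degree (gcd_graph n) v) \<and>
      independence_number H \<le>
        (\<Sum>k = 1..K. prime_quotient_count k n div k)
        + prime_pi (real n / (real K + 1)) + 2 * prime_pi (sqrt (real n)) + K\<^sup>2"
  using eventually_exp_ln_powr_square_le[OF assms(2)] eventually_ge_at_top[of 120]
proof eventually_elim
  case (elim n)
  then show ?case unfolding Let_def by (rule ex_switched_graph[rotated])
qed

end
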